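(* Let $N\in\mathbb N$ and $q_N:=\prod_{k=1}^N\frac{2k-1}{2k}$. Let $z_0\in P_N(\mathcal B)$ satisfy $z_0=z_0\circ z_0$, and suppose that the linear operator $x\mapsto x-2z_0\times x$ on $\mathcal B$ is invertible with bounded inverse $O_{z_0}$. Put $\kappa:=\|z_0\|$ and $M:=\|O_{z_0}\|$ (operator norm). Suppose $4M^2\kappa^2\sqrt{q_N}<1$ and define $$\epsilon:=\frac1{2M}\sum_{n=1}^\infty\frac{1\cdot3\cdots(2n-3)}{2^n\,n!}\,(4\sqrt{q_N}\,M^2\kappa^2)^n$$ (the product $1\cdot3\cdots(2n-3)$ being $1$ for $n=1$). Define $G_{z_0}:\mathcal B\to\mathcal B$ by $G_{z_0}(r):=O_{z_0}(z_0\bullet z_0+r\times r)$. Let $\overline U_\epsilon:=\{x\in\mathcal B:\|x\|\le\epsilon\}$ and $U_\epsilon:=\{x\in\mathcal B:\|x\|<\epsilon\}$. Then $G_{z_0}(\overline U_\epsilon)\subseteq\overline U_\epsilon$, and $\|G_{z_0}(r_1)-G_{z_0}(r_2)\|\le K\|r_1-r_2\|$ for all $r_1,r_2\in U_\epsilon$, where $K:=2M\epsilon$. Suppose moreover $K<1$, and define recursively $r^{(0)}:=0$, $r^{(n+1)}:=G_{z_0}(r^{(n)})$. Then $r_*:=\lim_{n\to\infty}r^{(n)}=\sum_{n=1}^\infty(r^{(n)}-r^{(n-1)})$ exists in $\mathcal B$, $G_{z_0}(r_* )=r_*$, $$\|r_*\|\le\frac{M\sqrt{q_N}\,\kappa^2}{1-K},$$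 and $z:=z_0+r_*$ satisfies $z=z\times z$.
   Context: Let $d>2$ be real, $\beta:=2^{-\frac{d+2}{2d}}$ (so $2\beta^2<1$) and $\rho:=\frac{\beta}{1-2\beta^2}$. For a real sequence $x=(x_0,x_1,x_2,\dots)$ put $\|x\|:=\sum_{n=0}^\infty|x_n|\rho^n$, and let $\mathcal B:=\{x\in\mathbb R^{\infty}:\|x\|<\infty\}$. The product $\times$ on $\mathcal B$ is $$(a\times b)_l:=\sum_{m,n\ge0,\ |m-n|\le l\le m+n}\beta^{l+m+n}B(l,m,n)\,a_mb_n,$$ $$B(l,m,n):=\sqrt{\frac{(2l)!}{(2m)!(2n)!}}\;\frac{(2m)!\,(2n)!}{(m+n-l)!\,(l+n-m)!\,(l+m-n)!}.$$ $P_N:\mathcal B\to\mathcal B$ is the projection $P_N(z_0,z_1,z_2,\dots):=(z_0,\dots,z_N,0,0,\dots)$; $a\circ b:=P_N(a\times b)$ and $a\bullet b:=(1-P_N)(a\times b)$. *)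

theory Defs
  imports "HOL-Analysis.Analysis"
begin

type_synonym rseq = "nat \<Rightarrow> real"

definition beta :: "real \<Rightarrow> real" where
  "beta d = 2 powr (- (d + 2) / (2 * d))"

definition rho :: "real \<Rightarrow> real" where
  "rho d = beta d / (1 - 2 * (beta d)\<^sup>2)"

text \<open>The space depends on the real parameter \<open>d\<close>, so it is a carrier set of sequences
  rather than a type; \<open>wnorm\<close> is meaningful on \<open>wspace\<close> only.\<close>

definition wspace :: "real \<Rightarrow> rseq set" where
  "wspace d = {x. summable (\<lambda>n. \<bar>x n\<bar> * rho d ^ n)}"

definition wnorm :: "real \<Rightarrow> rseq \<Rightarrow> real" where
  "wnorm d x = (\<Sum>n. \<bar>x n\<bar> * rho d ^ n)"

definition wcball :: "real \<Rightarrow> real \<Rightarrow> rseq set" where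
  "wcball d e = {x \<in> wspace d. wnorm d x \<le> e}"

definition wball :: "real \<Rightarrow> real \<Rightarrow> rseq set" where
  "wball d e = {x \<in> wspace d. wnorm d x < e}"

definition wlim :: "real \<Rightarrow> (nat \<Rightarrow> rseq) \<Rightarrow> rseq \<Rightarrow> bool" where
  "wlim d s x \<longleftrightarrow> (\<forall>n. s n \<in> wspace d) \<and> x \<in> wspace d \<and>
     (\<lambda>n. wnorm d (\<lambda>k. s n k - x k)) \<longlonglongrightarrow> 0"

definition wbounded :: "real \<Rightarrow> (rseq \<Rightarrow> rseq) \<Rightarrow> bool" where
  "wbounded d T \<longleftrightarrow> (\<exists>C. \<forall>x\<in>wspace d. wnorm d (T x) \<le> C * wnorm d x)"

text \<open>The analogue of \<^const>\<open>onorm\<close> for the carrier set; as there, \<open>x / 0 = 0\<close> makes the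
  zero sequence contribute \<open>0\<close>.\<close>

definition wonorm :: "real \<Rightarrow> (rseq \<Rightarrow> rseq) \<Rightarrow> real" where
  "wonorm d T = (SUP x\<in>wspace d. wnorm d (T x) / wnorm d x)"

text \<open>Used only for \<open>\<bar>m - n\<bar> \<le> l \<le> m + n\<close>, where no subtraction truncates.\<close>

definition Bcoeff :: "nat \<Rightarrow> nat \<Rightarrow> nat \<Rightarrow> real" where
  "Bcoeff l m n = sqrt (fact (2 * l) / (fact (2 * m) * fact (2 * n))) *
     (fact (2 * m) * fact (2 * n) / (fact (m + n - l) * fact (l + n - m) * fact (l + m - n)))"

definition seq_prod :: "real \<Rightarrow> rseq \<Rightarrow> rseq \<Rightarrow> rseq" where
  "seq_prod d a b = (\<lambda>l. \<Sum>\<^sub>\<infinity>(m, n)\<in>{(m, n). \<bar>int m - int n\<bar> \<le> int l \<and> l \<le> m + n}.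
     beta d ^ (l + m + n) * Bcoeff l m n * a m * b n)"

definition proj :: "nat \<Rightarrow> rseq \<Rightarrow> rseq" where
  "proj N z = (\<lambda>k. if k \<le> N then z k else 0)"

definition circ_prod :: "real \<Rightarrow> nat \<Rightarrow> rseq \<Rightarrow> rseq \<Rightarrow> rseq" where
  "circ_prod d N a b = proj N (seq_prod d a b)"

definition bullet_prod :: "real \<Rightarrow> nat \<Rightarrow> rseq \<Rightarrow> rseq \<Rightarrow> rseq" where
  "bullet_prod d N a b = (\<lambda>k. seq_prod d a b k - proj N (seq_prod d a b) k)"

definition qN :: "nat \<Rightarrow> real" where
  "qN N = (\<Prod>k=1..N. (2 * real k - 1) / (2 * real k))"

definition lin_op :: "real \<Rightarrow> rseq \<Rightarrow> rseq \<Rightarrow> rseq" where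
  "lin_op d z0 x = (\<lambda>k. x k - 2 * seq_prod d z0 x k)"

definition O_inv :: "real \<Rightarrow> rseq \<Rightarrow> rseq \<Rightarrow> rseq" where
  "O_inv d z0 = inv_into (wspace d) (lin_op d z0)"

definition G_map :: "real \<Rightarrow> nat \<Rightarrow> rseq \<Rightarrow> rseq \<Rightarrow> rseq" where
  "G_map d N z0 r = O_inv d z0 (\<lambda>k. bullet_prod d N z0 z0 k + seq_prod d r r k)"

text \<open>The coefficient \<open>1 \<cdot> 3 \<cdots> (2n - 3) / (2^n n!)\<close>, for \<open>n \<ge> 1\<close>.\<close>

definition eps_coeff :: "nat \<Rightarrow> real" where
  "eps_coeff n = (\<Prod>k=1..<n. 2 * real k - 1) / (2 ^ n * fact n)"

end

theory Submission
  imports Defs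
begin

text \<open>The key estimate is
  \<open>B(l, m, n) \<le> 2\<^sup>l binom(m + n, l) sqrt(q\<^sub>l)\<close>. Since
  \<open>\<beta> = \<rho> (1 - t)\<close> for \<open>t = 2 \<beta>\<^sup>2\<close>, it bounds the weight
  \<open>\<beta>\<^bsup>l+m+n\<^esup> B(l, m, n) \<rho>\<^sup>l\<close> by \<open>\<rho>\<^bsup>m+n\<^esup> sqrt(q\<^sub>l)\<close> times the binomial probability
  \<open>binom(m + n, l) t\<^sup>l (1 - t)\<^bsup>m+n-l\<^esup>\<close>. Summing over \<open>l\<close> gives
  \<open>\<parallel>a \<times> b\<parallel> \<le> \<parallel>a\<parallel> \<parallel>b\<parallel>\<close>, and summing over \<open>l > N\<close> only gives
  \<open>\<parallel>a \<bullet> b\<parallel> \<le> sqrt(q\<^sub>N) \<parallel>a\<parallel> \<parallel>b\<parallel>\<close>, as \<open>q\<close> is decreasing. Then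
  \<open>\<parallel>G r\<parallel> \<le> M (sqrt(q\<^sub>N) \<kappa>\<^sup>2 + \<parallel>r\<parallel>\<^sup>2)\<close>, and \<open>\<epsilon>\<close> is the smaller root of
  \<open>M (sqrt(q\<^sub>N) \<kappa>\<^sup>2 + \<epsilon>\<^sup>2) = \<epsilon>\<close>; the rest is the contraction principle in a Banach
  algebra, and a fixed point of \<open>G\<close> is exactly a correction making \<open>z\<^sub>0\<close> idempotent.\<close>

subsection \<open>The coefficients\<close>

text \<open>\<open>fact (a + j) / fact a\<close> is a product of \<open>j\<close> factors
  \<open>a + i\<close>, each at most the factor \<open>c + i\<close> of
  \<open>fact (c + j) / fact c\<close>.\<close>

lemma fact_mult_shift_le:
  assumes "a \<le> c"
  shows "(fact (a + j) :: real) * fact c \<le> fact a * fact (c + j)"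
proof (induction j)
  case (Suc j)
  have "(fact (a + Suc j) :: real) * fact c = (real a + real j + 1) * (fact (a + j) * fact c)"
    by (simp add: algebra_simps)
  also have "\<dots> \<le> (real c + real j + 1) * (fact a * fact (c + j))"
    using assms by (intro mult_mono[OF _ Suc]) auto
  also have "\<dots> = fact a * fact (c + Suc j)"
    by (simp add: algebra_simps)
  finally show ?case .
qed simp

text \<open>Log-convexity of the factorial: for \<open>a = l - j\<close> and
  \<open>b = l + j\<close> it is the shift inequality with \<open>c = l\<close>.\<close>

lemma fact_mean_le:
  assumes "a + b = 2 * l"
  shows "(fact l :: real)\<^sup>2 \<le> fact a * fact b"
proof -
  have *: "(fact l :: real)\<^sup>2 \<le> fact a * fact b" if "a \<le> l" "a + b = 2 * l" for a b
  proof -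
    have "a + (l - a) = l" "l + (l - a) = b" using that by auto
    then show ?thesis
      using fact_mult_shift_le[of a l "l - a"] that by (simp add: power2_eq_square)
  qed
  show ?thesis
  proof (cases "a \<le> l")
    case False
    then show ?thesis using *[of b a] assms by (simp add: mult.commute)
  qed (use * assms in auto)
qed

text \<open>AM-GM factor by factor: the factors \<open>a + k\<close> and \<open>b + k\<close> have
  mean \<open>l + k\<close>, for \<open>k = 1, ..., i\<close>.\<close>

lemma fact_mean_shift_le:
  assumes "a + b = 2 * l"
  shows "(fact (a + i) :: real) * fact (b + i) * (fact l)\<^sup>2
           \<le> fact a * fact b * (fact (l + i))\<^sup>2"
proof (induction i)
  case (Suc i)
  define x where "x = real a - real l"
  have ab: "real a = real l + x" "real b = real l - x"
    using assms unfolding x_def by linarith+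
  have "(fact (a + Suc i) :: real) * fact (b + Suc i) * (fact l)\<^sup>2
      = ((real a + real i + 1) * (real b + real i + 1)) * (fact (a + i) * fact (b + i) * (fact l)\<^sup>2)"
    by (simp add: algebra_simps)
  also have "\<dots> \<le> (real l + real i + 1)\<^sup>2 * (fact a * fact b * (fact (l + i))\<^sup>2)"
  proof (intro mult_mono[OF _ Suc])
    have "(real a + real i + 1) * (real b + real i + 1) = (real l + real i + 1)\<^sup>2 - x\<^sup>2"
      unfolding ab by (simp add: algebra_simps power2_eq_square)
    then show "(real a + real i + 1) * (real b + real i + 1) \<le> (real l + real i + 1)\<^sup>2"
      by simp
  qed auto
  also have "\<dots> = fact a * fact b * (fact (l + Suc i))\<^sup>2"
    by (simp add: algebra_simps power2_eq_square)
  finally show ?case .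
qed simp

section \<open>The numbers q_N and the bound on B(l, m, n)\<close>

lemma qN_Suc: "qN (Suc N) = qN N * ((2 * real N + 1) / (2 * real N + 2))"
  by (simp add: qN_def algebra_simps)

lemma qN_0 [simp]: "qN 0 = 1"
  by (simp add: qN_def)

lemma qN_nonneg: "qN N \<ge> 0"
  unfolding qN_def by (intro prod_nonneg) auto

lemma qN_antimono: "N \<le> l \<Longrightarrow> qN l \<le> qN N"
proof (induction l rule: dec_induct)
  case (step l)
  have "qN (Suc l) \<le> qN l * 1"
    unfolding qN_Suc by (intro mult_left_mono qN_nonneg) auto
  then show ?case using step by simp
qed simp

text \<open>Identifies \<open>4 ^ N * qN N\<close> with the central binomial coefficient, the form
  in which \<open>qN\<close> enters the square of \<open>Bcoeff\<close>.\<close>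

lemma qN_eq: "4 ^ N * qN N = fact (2 * N) / (fact N)\<^sup>2"
proof (induction N)
  case (Suc N)
  have "4 ^ Suc N * qN (Suc N) = (4 ^ N * qN N) * (4 * ((2 * real N + 1) / (2 * real N + 2)))"
    by (simp add: qN_Suc)
  also have "\<dots> = fact (2 * Suc N) / (fact (Suc N))\<^sup>2"
    unfolding Suc by (simp add: divide_simps power2_eq_square) (simp add: algebra_simps)
  finally show ?case .
qed simp

lemma Bcoeff_nonneg: "Bcoeff l m n \<ge> 0"
  by (simp add: Bcoeff_def)

text \<open>In the variables \<open>a\<close>, \<open>b\<close>, \<open>i\<close> of the proof,
  \<open>a + b = 2 * l\<close>, and the square becomes (2l)! (a+i)! (b+i)! / (i! a! b!)^2. Moving
  both \<open>a\<close> and \<open>b\<close> to their mean \<open>l\<close> can only increase this,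
  and the bound is the value there; it is attained for \<open>m = n\<close>.\<close>

lemma Bcoeff_le:
  assumes "\<bar>int m - int n\<bar> \<le> int l" "l \<le> m + n"
  shows "Bcoeff l m n \<le> 2 ^ l * real ((m + n) choose l) * sqrt (qN l)"
proof (rule power2_le_imp_le)
  define a b i where "a = l + m - n" and "b = l + n - m" and "i = m + n - l"
  have ab: "a + b = 2 * l" and m: "2 * m = a + i" and n: "2 * n = b + i" and s: "m + n = l + i"
    using assms unfolding a_def b_def i_def by linarith+
  let ?A = "fact a :: real" and ?B = "fact b :: real" and ?I = "fact i :: real"
  let ?L = "fact l :: real"
  have "(Bcoeff l m n)\<^sup>2
      = fact (2 * l) / (fact (a + i) * fact (b + i)) * (fact (a + i) * fact (b + i) / (?I * ?B * ?A))\<^sup>2"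
    unfolding Bcoeff_def a_def[symmetric] b_def[symmetric] i_def[symmetric] m n power_mult_distrib
    by (simp add: add.commute)
  also have "\<dots> = fact (2 * l) * (fact (a + i) * fact (b + i)) / (?I\<^sup>2 * (?A * ?B)\<^sup>2)"
    by (simp add: divide_simps power2_eq_square)
  also have "\<dots> \<le> fact (2 * l) * ((fact (l + i))\<^sup>2 / (?L\<^sup>2 * ?I\<^sup>2 * ?L\<^sup>2))"
  proof -
    \<comment> \<open>The denominator contains \<open>?A * ?B\<close> twice: one copy is spent on
      the shift by \<open>i\<close>, the other is compared with \<open>?L\<close> squared.\<close>
    have "fact (a + i) * fact (b + i) * ?L\<^sup>2 * ?L\<^sup>2 \<le> (?A * ?B * (fact (l + i))\<^sup>2) * (?A * ?B)"
      by (intro mult_mono fact_mean_shift_le fact_mean_le ab) auto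
    then have "fact (a + i) * fact (b + i) / (?I\<^sup>2 * (?A * ?B)\<^sup>2)
        \<le> (fact (l + i))\<^sup>2 / (?L\<^sup>2 * ?I\<^sup>2 * ?L\<^sup>2)"
      by (subst frac_le_eq) (auto simp: divide_simps power2_eq_square algebra_simps)
    then have "fact (2 * l) * (fact (a + i) * fact (b + i) / (?I\<^sup>2 * (?A * ?B)\<^sup>2))
        \<le> fact (2 * l) * ((fact (l + i))\<^sup>2 / (?L\<^sup>2 * ?I\<^sup>2 * ?L\<^sup>2))"
      by (intro mult_left_mono) auto
    then show ?thesis by simp
  qed
  also have "\<dots> = (fact (l + i) / (?L * ?I))\<^sup>2 * (fact (2 * l) / ?L\<^sup>2)"
    by (simp add: power_divide power_mult_distrib)
  also have "fact (l + i) / (?L * ?I) = real ((m + n) choose l)"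
    unfolding s by (subst binomial_fact) auto
  also have "fact (2 * l) / ?L\<^sup>2 = (2 ^ l)\<^sup>2 * qN l"
    unfolding qN_eq[symmetric] by (simp add: power_mult[symmetric] mult.commute[of l] power_mult)
  also have "(real ((m + n) choose l))\<^sup>2 * ((2 ^ l)\<^sup>2 * qN l)
      = (2 ^ l * real ((m + n) choose l) * sqrt (qN l))\<^sup>2"
    using qN_nonneg by (simp add: power_mult_distrib)
  finally show "(Bcoeff l m n)\<^sup>2 \<le> (2 ^ l * real ((m + n) choose l) * sqrt (qN l))\<^sup>2" .
qed (use qN_nonneg in auto)

lemma Bcoeff_commute: "Bcoeff l m n = Bcoeff l n m"
  by (simp add: Bcoeff_def mult_ac add_ac)

text \<open>Both sides start at 1/2 and have the ratio (2n + 1) / (2(n + 2)) of consecutive terms.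
  Hence the sum defining epsilon is the binomial series of \<open>1 - sqrt (1 - x)\<close>.\<close>

lemma eps_coeff_Suc: "eps_coeff (Suc n) = - (((1/2) gchoose Suc n) * (-1) ^ Suc n)"
proof (induction n)
  case (Suc n)
  have "eps_coeff (Suc (Suc n)) = eps_coeff (Suc n) * ((2 * real n + 1) / (2 * (real n + 2)))"
    by (simp add: eps_coeff_def prod.op_ivl_Suc divide_simps) (simp add: algebra_simps)
  moreover have "((1/2 :: real) gchoose Suc (Suc n))
      = - (((1/2) gchoose Suc n) * ((2 * real n + 1) / (2 * (real n + 2))))"
    using gbinomial_mult_1[of "1/2 :: real" "Suc n"]
    by (simp add: field_simps)
  ultimately show ?case
    unfolding Suc by simp
qed (simp add: eps_coeff_def)

lemma eps_series:
  assumes "\<bar>x\<bar> < 1"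
  shows "(\<Sum>n. eps_coeff (Suc n) * x ^ Suc n) = 1 - sqrt (1 - x)"
proof -
  have "(\<lambda>n. ((1/2) gchoose n) * (-x) ^ n) sums sqrt (1 - x)"
    using sqrt_series[of "-x"] assms by simp
  then have "(\<lambda>n. ((1/2) gchoose Suc n) * (-x) ^ Suc n) sums (sqrt (1 - x) - 1)"
    by (subst sums_Suc_iff) simp
  then have "(\<lambda>n. - (((1/2) gchoose Suc n) * (-x) ^ Suc n)) sums - (sqrt (1 - x) - 1)"
    by (rule sums_minus)
  moreover have "- (((1/2) gchoose Suc n) * (-x) ^ Suc n) = eps_coeff (Suc n) * x ^ Suc n" for n
    unfolding eps_coeff_Suc power_minus[of x] by (simp only: mult.assoc minus_mult_left)
  ultimately have "(\<lambda>n. eps_coeff (Suc n) * x ^ Suc n) sums - (sqrt (1 - x) - 1)"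
    by (simp only:)
  then show ?thesis
    using sums_unique by fastforce
qed

subsection \<open>The weighted sequence space\<close>

context
  fixes d :: real
  assumes d: "d > 2"
begin

lemma beta_pos: "beta d > 0"
  by (simp add: beta_def)

text \<open>The exponents combine to 2 beta^2 = 2^(-2/d). This makes \<open>rho d\<close> positive
  and lets 2 beta^2 serve as a success probability.\<close>

lemma beta_sq: "2 * (beta d)\<^sup>2 < 1"
proof -
  have "2 * (beta d)\<^sup>2 = 2 powr 1 * 2 powr (- (d + 2) / d)"
    using d by (simp add: beta_def power2_eq_square powr_add[symmetric])
  also have "\<dots> = 2 powr (- 2 / d)"
    using d by (simp only: powr_add[symmetric]) (simp add: field_simps)
  also have "\<dots> < 2 powr 0"
    using d by (intro powr_less_mono) auto
  finally show ?thesis by simp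
qed

lemma rho_pos: "rho d > 0"
  using beta_pos beta_sq by (simp add: rho_def)

lemma wspace_zero: "(\<lambda>_. 0) \<in> wspace d"
  by (simp add: wspace_def)

lemma wspace_add:
  assumes "x \<in> wspace d" "y \<in> wspace d"
  shows "(\<lambda>k. x k + y k) \<in> wspace d" "wnorm d (\<lambda>k. x k + y k) \<le> wnorm d x + wnorm d y"
proof -
  have le: "\<bar>x k + y k\<bar> * rho d ^ k \<le> \<bar>x k\<bar> * rho d ^ k + \<bar>y k\<bar> * rho d ^ k" for k
    using mult_right_mono[OF abs_triangle_ineq[of "x k" "y k"], of "rho d ^ k"] rho_pos
    by (simp add: distrib_right)
  have s: "summable (\<lambda>k. \<bar>x k\<bar> * rho d ^ k)" "summable (\<lambda>k. \<bar>y k\<bar> * rho d ^ k)"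
    using assms by (auto simp: wspace_def)
  have "summable (\<lambda>k. \<bar>x k + y k\<bar> * rho d ^ k)"
    by (rule summable_comparison_test'[OF summable_add[OF s], of 0])
      (use rho_pos le in \<open>auto simp: abs_mult\<close>)
  moreover from this have "wnorm d (\<lambda>k. x k + y k) \<le> (\<Sum>k. \<bar>x k\<bar> * rho d ^ k + \<bar>y k\<bar> * rho d ^ k)"
    unfolding wnorm_def by (intro suminf_le le summable_add s)
  ultimately show "(\<lambda>k. x k + y k) \<in> wspace d"
    "wnorm d (\<lambda>k. x k + y k) \<le> wnorm d x + wnorm d y"
    using suminf_add[OF s] by (auto simp: wspace_def wnorm_def)
qed

lemma wspace_cmult:
  assumes "x \<in> wspace d"
  shows "(\<lambda>k. c * x k) \<in> wspace d" "wnorm d (\<lambda>k. c * x k) = \<bar>c\<bar> * wnorm d x"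
  using assms summable_mult[of "\<lambda>k. \<bar>x k\<bar> * rho d ^ k" "\<bar>c\<bar>"]
    suminf_mult[of "\<lambda>k. \<bar>x k\<bar> * rho d ^ k" "\<bar>c\<bar>"]
  by (auto simp: wspace_def wnorm_def abs_mult mult.assoc)

lemma wspace_diff:
  assumes "x \<in> wspace d" "y \<in> wspace d"
  shows "(\<lambda>k. x k - y k) \<in> wspace d" "wnorm d (\<lambda>k. x k - y k) \<le> wnorm d x + wnorm d y"
  using wspace_add[OF assms(1) wspace_cmult(1)[OF assms(2), of "-1"]]
    wspace_cmult(2)[OF assms(2), of "-1"] by auto

lemma wnorm_diff_commute: "wnorm d (\<lambda>k. x k - y k) = wnorm d (\<lambda>k. y k - x k)"
  by (simp add: wnorm_def abs_minus_commute)

lemma wnorm_diff_triangle: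
  assumes "x \<in> wspace d" "y \<in> wspace d" "z \<in> wspace d"
  shows "wnorm d (\<lambda>k. x k - z k) \<le> wnorm d (\<lambda>k. x k - y k) + wnorm d (\<lambda>k. y k - z k)"
  using wspace_add(2)[OF wspace_diff(1)[OF assms(1,2)] wspace_diff(1)[OF assms(2,3)]] by simp

lemma wnorm_nonneg: "x \<in> wspace d \<Longrightarrow> wnorm d x \<ge> 0"
  using rho_pos by (auto simp: wnorm_def wspace_def intro!: suminf_nonneg)

lemma wnorm_zero: "wnorm d (\<lambda>_. 0) = 0"
  by (simp add: wnorm_def)

lemma wnorm_eq_0:
  assumes "x \<in> wspace d" "wnorm d x = 0"
  shows "x = (\<lambda>_. 0)"
proof
  fix k
  have "(\<Sum>n. \<bar>x n\<bar> * rho d ^ n) = 0 \<longleftrightarrow> (\<forall>n. \<bar>x n\<bar> * rho d ^ n = 0)"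
    using assms rho_pos by (intro suminf_eq_zero_iff) (auto simp: wspace_def)
  then show "x k = 0" using assms rho_pos by (auto simp: wnorm_def)
qed

text \<open>Lets later norm estimates be carried out on finite sections, so that no two infinite
  sums have to be interchanged; membership comes along with the bound.\<close>

lemma wspace_bounded_partial_sums:
  assumes "\<And>n. (\<Sum>k<n. \<bar>x k\<bar> * rho d ^ k) \<le> C"
  shows "x \<in> wspace d" "wnorm d x \<le> C"
proof -
  have "summable (\<lambda>k. \<bar>x k\<bar> * rho d ^ k)"
    using assms rho_pos by (intro summableI_nonneg_bounded[of _ C]) auto
  then show "x \<in> wspace d" "wnorm d x \<le> C"
    using assms by (auto simp: wspace_def wnorm_def intro!: suminf_le_const)
qed

text \<open>Completeness in the form "absolutely convergent series converge", which fits the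
  telescoping series of the iteration. The limit is formed coordinatewise, and the remainder is
  controlled by the tail of the series of norms.\<close>

lemma wspace_complete:
  fixes u :: "nat \<Rightarrow> rseq"
  assumes u: "\<And>n. u n \<in> wspace d" and s: "summable (\<lambda>n. wnorm d (u n))"
  obtains x where "wlim d (\<lambda>n k. \<Sum>j<n. u j k) x"
proof -
  let ?x = "\<lambda>k. \<Sum>j. u j k"
  have coord: "\<bar>u j k\<bar> \<le> wnorm d (u j) / rho d ^ k" for j k
  proof -
    have "(\<Sum>i\<in>{k}. \<bar>u j i\<bar> * rho d ^ i) \<le> wnorm d (u j)"
      unfolding wnorm_def using u rho_pos by (intro sum_le_suminf) (auto simp: wspace_def)
    then show ?thesis using rho_pos by (simp add: field_simps)
  qed
  have abs_summable: "summable (\<lambda>j. \<bar>u j k\<bar>)" for k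
    by (rule summable_comparison_test'[OF summable_divide[OF s, of "rho d ^ k"], of 0])
      (use coord in auto)
  have summable: "summable (\<lambda>j. u j k)" for k
    by (rule summable_rabs_cancel[OF abs_summable])
  have tail: "(\<lambda>k. ?x k - (\<Sum>j<n. u j k)) \<in> wspace d"
    "wnorm d (\<lambda>k. ?x k - (\<Sum>j<n. u j k)) \<le> (\<Sum>j. wnorm d (u (j + n)))" for n
  proof -
    have eq: "?x k - (\<Sum>j<n. u j k) = (\<Sum>j. u (j + n) k)" for k
      using suminf_split_initial_segment[OF summable[of k], of n] by simp
    \<comment> \<open>Cutting at \<open>k < m\<close> leaves only a finite sum to be exchanged with
      the series over \<open>j\<close>; the bound does not depend on \<open>m\<close>.\<close>
    have "(\<Sum>k<m. \<bar>?x k - (\<Sum>j<n. u j k)\<bar> * rho d ^ k) \<le> (\<Sum>j. wnorm d (u (j + n)))" for m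
    proof -
      have sa: "summable (\<lambda>j. \<bar>u (j + n) k\<bar>)" for k
        using abs_summable[of k] by (rule summable_ignore_initial_segment)
      have "(\<Sum>k<m. \<bar>?x k - (\<Sum>j<n. u j k)\<bar> * rho d ^ k) \<le> (\<Sum>k<m. (\<Sum>j. \<bar>u (j + n) k\<bar>) * rho d ^ k)"
        unfolding eq using rho_pos by (intro sum_mono mult_right_mono summable_rabs sa) auto
      also have "\<dots> = (\<Sum>k<m. \<Sum>j. \<bar>u (j + n) k\<bar> * rho d ^ k)"
        by (intro sum.cong refl suminf_mult2 sa)
      also have "\<dots> = (\<Sum>j. \<Sum>k<m. \<bar>u (j + n) k\<bar> * rho d ^ k)"
        by (intro suminf_sum[symmetric] summable_mult2 sa)
      also have "\<dots> \<le> (\<Sum>j. wnorm d (u (j + n)))"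
      proof (intro suminf_le)
        show "(\<Sum>k<m. \<bar>u (j + n) k\<bar> * rho d ^ k) \<le> wnorm d (u (j + n))" for j
          unfolding wnorm_def using u rho_pos by (intro sum_le_suminf) (auto simp: wspace_def)
        show "summable (\<lambda>j. \<Sum>k<m. \<bar>u (j + n) k\<bar> * rho d ^ k)"
          by (intro summable_sum summable_mult2 sa)
        show "summable (\<lambda>j. wnorm d (u (j + n)))"
          using s by (rule summable_ignore_initial_segment)
      qed
      finally show ?thesis .
    qed
    from wspace_bounded_partial_sums[OF this]
    show "(\<lambda>k. ?x k - (\<Sum>j<n. u j k)) \<in> wspace d"
      "wnorm d (\<lambda>k. ?x k - (\<Sum>j<n. u j k)) \<le> (\<Sum>j. wnorm d (u (j + n)))"
      by auto
  qed
  have part: "(\<lambda>k. \<Sum>j<n. u j k) \<in> wspace d" for n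
    by (induction n) (auto simp: wspace_zero intro!: wspace_add(1) u)
  have "(\<lambda>n. wnorm d (\<lambda>k. (\<Sum>j<n. u j k) - ?x k)) \<longlonglongrightarrow> 0"
  proof (rule real_tendsto_sandwich)
    show "eventually (\<lambda>n. wnorm d (\<lambda>k. (\<Sum>j<n. u j k) - ?x k) \<le> (\<Sum>j. wnorm d (u (j + n)))) sequentially"
      using tail(2) by (subst wnorm_diff_commute) auto
    show "eventually (\<lambda>n. 0 \<le> wnorm d (\<lambda>k. (\<Sum>j<n. u j k) - ?x k)) sequentially"
      using wnorm_nonneg[OF tail(1)] by (subst wnorm_diff_commute) auto
    show "(\<lambda>n. \<Sum>j. wnorm d (u (j + n))) \<longlonglongrightarrow> 0"
      using suminf_exist_split2[OF s] by simp
  qed simp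
  \<comment> \<open>The remainder after zero terms is the limit itself.\<close>
  moreover have "?x \<in> wspace d"
    using tail(1)[of 0] by simp
  ultimately have "wlim d (\<lambda>n k. \<Sum>j<n. u j k) ?x"
    using part by (auto simp: wlim_def)
  then show thesis by (rule that)
qed

subsection \<open>The product\<close>

text \<open>Extending the coefficient by zero outside the triangle region lets all sums run over all
  pairs, with an index set independent of \<open>l\<close>.\<close>

definition kern :: "nat \<Rightarrow> nat \<Rightarrow> nat \<Rightarrow> real" where
  "kern l m n = (if \<bar>int m - int n\<bar> \<le> int l \<and> l \<le> m + n
     then beta d ^ (l + m + n) * Bcoeff l m n else 0)"

lemma kern_nonneg: "kern l m n \<ge> 0"
  using beta_pos Bcoeff_nonneg by (simp add: kern_def)

lemma kern_commute: "kern l m n = kern l n m"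
  by (simp add: kern_def Bcoeff_commute[of l m n] abs_minus_commute add_ac)

lemma kern_le:
  "kern l m n * rho d ^ l \<le> rho d ^ (m + n) * sqrt (qN l) *
     (real ((m + n) choose l) * (2 * (beta d)\<^sup>2) ^ l * (1 - 2 * (beta d)\<^sup>2) ^ (m + n - l))"
proof (cases "\<bar>int m - int n\<bar> \<le> int l \<and> l \<le> m + n")
  case True
  define i where "i = m + n - l"
  have mn: "m + n = l + i" using True by (simp add: i_def)
  have b: "beta d = rho d * (1 - 2 * (beta d)\<^sup>2)"
    using beta_sq by (simp add: rho_def)
  have "kern l m n * rho d ^ l = (beta d ^ (l + m + n) * rho d ^ l) * Bcoeff l m n"
    using True by (simp add: kern_def)
  also have "\<dots> \<le> (beta d ^ (l + m + n) * rho d ^ l) *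
      (2 ^ l * real ((m + n) choose l) * sqrt (qN l))"
    using True beta_pos rho_pos by (intro mult_left_mono Bcoeff_le) auto
  \<comment> \<open>Here l + m + n = 2l + i. The power beta^(2l) absorbs \<open>2 ^ l\<close> into
    t^l with t = 2 beta^2, and each of the other \<open>i\<close> factors beta is rho (1 -
    t).\<close>
  also have "beta d ^ (l + m + n) = (beta d ^ 2) ^ l * beta d ^ i"
    by (simp add: power_mult[symmetric] power_add[symmetric] mn add.assoc mult_2)
  also have "beta d ^ i = rho d ^ i * (1 - 2 * (beta d)\<^sup>2) ^ i"
    by (subst (1) b) (simp add: power_mult_distrib)
  finally show ?thesis
    by (simp add: mn power_add power_mult_distrib mult_ac)
next
  case False
  then show ?thesis
    using rho_pos beta_pos beta_sq qN_nonneg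
    by (auto simp: kern_def)
qed

text \<open>One statement for two uses: \<open>N = 0\<close> bounds the full product, and sets
  \<open>F\<close> beyond \<open>N\<close> bound its tail.\<close>

lemma sum_kern_le:
  assumes "finite F" "\<And>l. l \<in> F \<Longrightarrow> N \<le> l"
  shows "(\<Sum>l\<in>F. kern l m n * rho d ^ l) \<le> sqrt (qN N) * rho d ^ (m + n)"
proof -
  let ?t = "2 * (beta d)\<^sup>2"
  let ?w = "\<lambda>l. real ((m + n) choose l) * ?t ^ l * (1 - ?t) ^ (m + n - l)"
  have w: "?w l \<ge> 0" for l
    using beta_pos beta_sq by auto
  have "(\<Sum>l\<in>F. kern l m n * rho d ^ l) \<le> (\<Sum>l\<in>F. rho d ^ (m + n) * sqrt (qN N) * ?w l)"
  proof (rule sum_mono)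
    fix l assume "l \<in> F"
    then have "rho d ^ (m + n) * sqrt (qN l) * ?w l \<le> rho d ^ (m + n) * sqrt (qN N) * ?w l"
      using assms rho_pos by (intro mult_right_mono[OF _ w] mult_left_mono) (auto intro: qN_antimono)
    then show "kern l m n * rho d ^ l \<le> rho d ^ (m + n) * sqrt (qN N) * ?w l"
      using kern_le by (rule order_trans[rotated])
  qed
  also have "\<dots> = rho d ^ (m + n) * sqrt (qN N) * (\<Sum>l\<in>F. ?w l)"
    by (simp add: sum_distrib_left)
  also have "(\<Sum>l\<in>F. ?w l) \<le> 1"
  proof -
    \<comment> \<open>Binomial coefficients with \<open>l > m + n\<close> vanish, so at most the
      full binomial distribution of total mass 1 remains.\<close>
    have "(\<Sum>l\<in>F. ?w l) = (\<Sum>l\<in>F \<inter> {..m + n}. ?w l)"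
      using assms by (intro sum.mono_neutral_right) (auto simp: binomial_eq_0)
    also have "\<dots> \<le> (\<Sum>l\<le>m + n. ?w l)"
      by (intro sum_mono2 w) auto
    also have "\<dots> = (?t + (1 - ?t)) ^ (m + n)"
      by (rule binomial_ring[symmetric])
    finally show ?thesis by simp
  qed
  finally show ?thesis
    using rho_pos qN_nonneg by (simp add: mult_left_mono mult.commute[of "rho d ^ (m + n)"])
qed

text \<open>This double sum is the majorant for the product, both for summability and for the norm
  estimates.\<close>

lemma has_sum_wnorm_mult:
  assumes "a \<in> wspace d" "b \<in> wspace d"
  shows "((\<lambda>(m, n). rho d ^ (m + n) * \<bar>a m\<bar> * \<bar>b n\<bar>) has_sum (wnorm d a * wnorm d b)) UNIV"
proof -
  have hs: "((\<lambda>n. \<bar>x n\<bar> * rho d ^ n) has_sum wnorm d x) UNIV" if "x \<in> wspace d" for x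
    using that rho_pos unfolding wspace_def wnorm_def
    by (intro norm_summable_imp_has_sum) (auto simp: abs_mult summable_sums)
  have 1: "((\<lambda>n. rho d ^ (m + n) * \<bar>a m\<bar> * \<bar>b n\<bar>) has_sum (\<bar>a m\<bar> * rho d ^ m) * wnorm d b) UNIV" for m
    using has_sum_cmult_right[OF hs[OF assms(2)], of "\<bar>a m\<bar> * rho d ^ m"]
    by (simp add: power_add mult_ac)
  have 2: "((\<lambda>m. (\<bar>a m\<bar> * rho d ^ m) * wnorm d b) has_sum wnorm d a * wnorm d b) UNIV"
    by (intro has_sum_cmult_left hs assms)
  have "((\<lambda>(m, n). rho d ^ (m + n) * \<bar>a m\<bar> * \<bar>b n\<bar>) has_sum (wnorm d a * wnorm d b))
      (Sigma UNIV (\<lambda>_. UNIV))"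
    using 1 2 rho_pos
    by (intro has_sum_SigmaI[where g = "\<lambda>m. (\<bar>a m\<bar> * rho d ^ m) * wnorm d b"]
        summable_on_SigmaI[where g = "\<lambda>m. (\<bar>a m\<bar> * rho d ^ m) * wnorm d b"])
      (auto dest: has_sum_imp_summable)
  then show ?thesis by simp
qed

lemma kern_le_rho: "kern l m n \<le> rho d ^ (m + n) / rho d ^ l"
  using sum_kern_le[of "{l}" 0 m n] rho_pos by (simp add: field_simps)

lemma kern_abs_summable:
  assumes "a \<in> wspace d" "b \<in> wspace d"
  shows "(\<lambda>(m, n). kern l m n * \<bar>a m\<bar> * \<bar>b n\<bar>) summable_on UNIV"
proof (rule summable_on_comparison_test)
  show "(\<lambda>p. (case p of (m, n) \<Rightarrow> rho d ^ (m + n) * \<bar>a m\<bar> * \<bar>b n\<bar>) * (1 / rho d ^ l)) summable_on UNIV"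
    using has_sum_wnorm_mult[OF assms] by (intro summable_on_cmult_left) (rule has_sum_imp_summable)
  show "(case p of (m, n) \<Rightarrow> kern l m n * \<bar>a m\<bar> * \<bar>b n\<bar>)
      \<le> (case p of (m, n) \<Rightarrow> rho d ^ (m + n) * \<bar>a m\<bar> * \<bar>b n\<bar>) * (1 / rho d ^ l)" for p
  proof -
    obtain m n where p: "p = (m, n)" by (cases p)
    have "kern l m n * (\<bar>a m\<bar> * \<bar>b n\<bar>) \<le> rho d ^ (m + n) / rho d ^ l * (\<bar>a m\<bar> * \<bar>b n\<bar>)"
      by (intro mult_right_mono kern_le_rho) auto
    then show ?thesis by (simp add: p mult_ac)
  qed
  show "0 \<le> (case p of (m, n) \<Rightarrow> kern l m n * \<bar>a m\<bar> * \<bar>b n\<bar>)" for p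
    using kern_nonneg by (auto split: prod.split)
qed

text \<open>An infinite sum defaults to 0 when it is not summable, so domination has to be used
  before \<open>seq_prod\<close> can be computed with. The algebraic rules below then follow from
  uniqueness of sums.\<close>

lemma seq_prod_has_sum:
  assumes "a \<in> wspace d" "b \<in> wspace d"
  shows "((\<lambda>(m, n). kern l m n * a m * b n) has_sum seq_prod d a b l) UNIV"
proof -
  have "(\<lambda>p. norm (case p of (m, n) \<Rightarrow> kern l m n * a m * b n)) summable_on UNIV"
    using kern_abs_summable[OF assms, of l] kern_nonneg
    by (simp add: case_prod_unfold abs_mult)
  then have "(\<lambda>(m, n). kern l m n * a m * b n) summable_on UNIV"
    by (rule abs_summable_summable)
  moreover have "infsum (\<lambda>(m, n). kern l m n * a m * b n) UNIV = seq_prod d a b l"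
    unfolding seq_prod_def by (rule infsum_cong_neutral) (auto simp: kern_def split: if_splits)
  ultimately show ?thesis
    by (simp add: has_sum_iff)
qed

lemma seq_prod_add_left:
  assumes "a \<in> wspace d" "b \<in> wspace d" "c \<in> wspace d"
  shows "seq_prod d (\<lambda>k. a k + b k) c = (\<lambda>k. seq_prod d a c k + seq_prod d b c k)"
proof
  fix l
  have "((\<lambda>p. (case p of (m, n) \<Rightarrow> kern l m n * a m * c n) + (case p of (m, n) \<Rightarrow> kern l m n * b m * c n))
      has_sum seq_prod d a c l + seq_prod d b c l) UNIV"
    by (intro has_sum_add seq_prod_has_sum assms)
  moreover have "(\<lambda>p. (case p of (m, n) \<Rightarrow> kern l m n * a m * c n) + (case p of (m, n) \<Rightarrow> kern l m n * b m * c n))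
      = (\<lambda>(m, n). kern l m n * (a m + b m) * c n)"
    by (auto simp: algebra_simps)
  ultimately have "((\<lambda>(m, n). kern l m n * (a m + b m) * c n)
      has_sum seq_prod d a c l + seq_prod d b c l) UNIV"
    by (simp only:)
  with seq_prod_has_sum[OF wspace_add(1)[OF assms(1,2)] assms(3)]
  show "seq_prod d (\<lambda>k. a k + b k) c l = seq_prod d a c l + seq_prod d b c l"
    by (rule has_sum_unique)
qed

lemma seq_prod_cmult_left:
  assumes "a \<in> wspace d" "b \<in> wspace d"
  shows "seq_prod d (\<lambda>k. c * a k) b = (\<lambda>k. c * seq_prod d a b k)"
proof
  fix l
  have "((\<lambda>p. c * (case p of (m, n) \<Rightarrow> kern l m n * a m * b n)) has_sum c * seq_prod d a b l) UNIV"
    by (intro has_sum_cmult_right seq_prod_has_sum assms)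
  moreover have "(\<lambda>p. c * (case p of (m, n) \<Rightarrow> kern l m n * a m * b n))
      = (\<lambda>(m, n). kern l m n * (c * a m) * b n)"
    by (auto simp: algebra_simps)
  ultimately have "((\<lambda>(m, n). kern l m n * (c * a m) * b n) has_sum c * seq_prod d a b l) UNIV"
    by (simp only:)
  with seq_prod_has_sum[OF wspace_cmult(1)[OF assms(1)] assms(2)]
  show "seq_prod d (\<lambda>k. c * a k) b l = c * seq_prod d a b l"
    by (rule has_sum_unique)
qed

lemma seq_prod_commute:
  assumes "a \<in> wspace d" "b \<in> wspace d"
  shows "seq_prod d a b = seq_prod d b a"
proof
  fix l
  have "((\<lambda>(m, n). kern l m n * b m * a n) has_sum seq_prod d b a l) (prod.swap ` UNIV)"
    using seq_prod_has_sum[OF assms(2,1), of l] by simp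
  then have "((\<lambda>(m, n). kern l m n * b m * a n) \<circ> prod.swap has_sum seq_prod d b a l) UNIV"
    by (subst (asm) has_sum_reindex) auto
  moreover have "(\<lambda>(m, n). kern l m n * b m * a n) \<circ> prod.swap = (\<lambda>(m, n). kern l m n * a m * b n)"
    by (auto simp: kern_commute[of l] mult_ac)
  ultimately have "((\<lambda>(m, n). kern l m n * a m * b n) has_sum seq_prod d b a l) UNIV"
    by (simp only:)
  with seq_prod_has_sum[OF assms] show "seq_prod d a b l = seq_prod d b a l"
    by (rule has_sum_unique)
qed

lemma seq_prod_add_right:
  assumes "a \<in> wspace d" "b \<in> wspace d" "c \<in> wspace d"
  shows "seq_prod d c (\<lambda>k. a k + b k) = (\<lambda>k. seq_prod d c a k + seq_prod d c b k)"
  using seq_prod_add_left[OF assms] assms by (simp add: seq_prod_commute[of c] wspace_add)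

lemma seq_prod_cmult_right:
  assumes "a \<in> wspace d" "b \<in> wspace d"
  shows "seq_prod d a (\<lambda>k. c * b k) = (\<lambda>k. c * seq_prod d a b k)"
  using seq_prod_cmult_left[OF assms(2,1)] assms by (simp add: seq_prod_commute[of a] wspace_cmult)

section \<open>Norm estimates for the product\<close>

text \<open>For finite \<open>F\<close> the sum over \<open>l\<close> moves inside the sum over
  pairs, where \<open>sum_kern_le\<close> applies to each pair \<open>(m, n)\<close>.\<close>

lemma sum_seq_prod_le:
  assumes ab: "a \<in> wspace d" "b \<in> wspace d" and F: "finite F" "\<And>l. l \<in> F \<Longrightarrow> N \<le> l"
  shows "(\<Sum>l\<in>F. \<bar>seq_prod d a b l\<bar> * rho d ^ l) \<le> sqrt (qN N) * (wnorm d a * wnorm d b)"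
proof -
  let ?S = "\<lambda>l. \<Sum>\<^sub>\<infinity>(m, n). kern l m n * \<bar>a m\<bar> * \<bar>b n\<bar>"
  have "\<bar>seq_prod d a b l\<bar> \<le> ?S l" for l
  proof -
    have "norm (infsum (\<lambda>(m, n). kern l m n * a m * b n) UNIV)
        \<le> infsum (\<lambda>p. norm (case p of (m, n) \<Rightarrow> kern l m n * a m * b n)) UNIV"
      using kern_abs_summable[OF ab, of l] kern_nonneg
      by (intro norm_infsum_bound) (simp add: case_prod_unfold abs_mult)
    moreover have "(\<lambda>p. norm (case p of (m, n) \<Rightarrow> kern l m n * a m * b n))
        = (\<lambda>(m, n). kern l m n * \<bar>a m\<bar> * \<bar>b n\<bar>)"
      using kern_nonneg by (auto simp: abs_mult)
    ultimately show ?thesis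
      using infsumI[OF seq_prod_has_sum[OF ab, of l]] by simp
  qed
  then have "(\<Sum>l\<in>F. \<bar>seq_prod d a b l\<bar> * rho d ^ l) \<le> (\<Sum>l\<in>F. ?S l * rho d ^ l)"
    using rho_pos by (intro sum_mono mult_right_mono) auto
  also have "\<dots> \<le> sqrt (qN N) * (wnorm d a * wnorm d b)"
  proof (rule has_sum_mono)
    show "((\<lambda>p. \<Sum>l\<in>F. (case p of (m, n) \<Rightarrow> kern l m n * \<bar>a m\<bar> * \<bar>b n\<bar>) * rho d ^ l)
        has_sum (\<Sum>l\<in>F. ?S l * rho d ^ l)) UNIV"
      using F(1)
    proof (induction F)
      case (insert l F)
      have "((\<lambda>p. (case p of (m, n) \<Rightarrow> kern l m n * \<bar>a m\<bar> * \<bar>b n\<bar>) * rho d ^ l)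
          has_sum ?S l * rho d ^ l) UNIV"
        by (intro has_sum_cmult_left has_sum_infsum kern_abs_summable ab)
      from has_sum_add[OF this insert.IH] insert.hyps show ?case by simp
    qed simp
    show "((\<lambda>p. sqrt (qN N) * (case p of (m, n) \<Rightarrow> rho d ^ (m + n) * \<bar>a m\<bar> * \<bar>b n\<bar>))
        has_sum sqrt (qN N) * (wnorm d a * wnorm d b)) UNIV"
      by (intro has_sum_cmult_right has_sum_wnorm_mult ab)
    fix p :: "nat \<times> nat"
    obtain m n where p: "p = (m, n)" by (cases p)
    have "(\<Sum>l\<in>F. kern l m n * rho d ^ l) * (\<bar>a m\<bar> * \<bar>b n\<bar>)
        \<le> sqrt (qN N) * rho d ^ (m + n) * (\<bar>a m\<bar> * \<bar>b n\<bar>)"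
      by (intro mult_right_mono sum_kern_le F) auto
    then show "(\<Sum>l\<in>F. (case p of (m, n) \<Rightarrow> kern l m n * \<bar>a m\<bar> * \<bar>b n\<bar>) * rho d ^ l)
        \<le> sqrt (qN N) * (case p of (m, n) \<Rightarrow> rho d ^ (m + n) * \<bar>a m\<bar> * \<bar>b n\<bar>)"
      by (simp add: p sum_distrib_left mult_ac)
  qed
  finally show ?thesis .
qed

lemma seq_prod_wspace:
  assumes "a \<in> wspace d" "b \<in> wspace d"
  shows "seq_prod d a b \<in> wspace d" "wnorm d (seq_prod d a b) \<le> wnorm d a * wnorm d b"
  using wspace_bounded_partial_sums[of "seq_prod d a b"]
    sum_seq_prod_le[OF assms finite_lessThan, of _ 0] by auto

lemma bullet_prod_wspace:
  assumes "a \<in> wspace d" "b \<in> wspace d"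
  shows "bullet_prod d N a b \<in> wspace d"
    "wnorm d (bullet_prod d N a b) \<le> sqrt (qN N) * (wnorm d a * wnorm d b)"
proof -
  have "(\<Sum>k<n. \<bar>bullet_prod d N a b k\<bar> * rho d ^ k) \<le> sqrt (qN N) * (wnorm d a * wnorm d b)" for n
  proof -
    \<comment> \<open>The entries up to \<open>N\<close> are zero, so only indices to which the
      factor \<open>sqrt (qN N)\<close> applies are left.\<close>
    have "(\<Sum>k<n. \<bar>bullet_prod d N a b k\<bar> * rho d ^ k)
        = (\<Sum>k\<in>{..<n} \<inter> {N<..}. \<bar>seq_prod d a b k\<bar> * rho d ^ k)"
      by (intro sum.mono_neutral_cong_right) (auto simp: bullet_prod_def proj_def)
    also have "\<dots> \<le> sqrt (qN N) * (wnorm d a * wnorm d b)"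
      by (intro sum_seq_prod_le assms) auto
    finally show ?thesis .
  qed
  from wspace_bounded_partial_sums[OF this]
  show "bullet_prod d N a b \<in> wspace d"
    "wnorm d (bullet_prod d N a b) \<le> sqrt (qN N) * (wnorm d a * wnorm d b)" by auto
qed

text \<open>By commutativity the difference of squares factors as (a + b) x (a - b).\<close>

lemma seq_prod_square_diff:
  assumes "a \<in> wspace d" "b \<in> wspace d"
  shows "wnorm d (\<lambda>k. seq_prod d a a k - seq_prod d b b k)
    \<le> (wnorm d a + wnorm d b) * wnorm d (\<lambda>k. a k - b k)"
proof -
  \<comment> \<open>The difference is written with a factor \<open>-1\<close> so that the rules for
    sums and scalar multiples expand the product.\<close>
  let ?s = "\<lambda>k. a k + b k" and ?d = "\<lambda>k. a k + (-1) * b k"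
  note nb = wspace_cmult(1)[OF assms(2), of "-1"]
  have s: "?s \<in> wspace d" and d': "?d \<in> wspace d"
    by (intro wspace_add(1) assms nb)+
  have "seq_prod d ?s ?d = (\<lambda>k. seq_prod d a a k + seq_prod d b a k
      + (- 1) * (seq_prod d a b k + seq_prod d b b k))"
    using assms nb s
    by (simp only: seq_prod_add_right seq_prod_cmult_right seq_prod_add_left)
  also have "\<dots> = (\<lambda>k. seq_prod d a a k - seq_prod d b b k)"
    by (simp add: seq_prod_commute[OF assms])
  finally have "wnorm d (\<lambda>k. seq_prod d a a k - seq_prod d b b k) \<le> wnorm d ?s * wnorm d ?d"
    using seq_prod_wspace(2)[OF s d'] by simp
  also have "\<dots> \<le> (wnorm d a + wnorm d b) * wnorm d ?d"
    by (intro mult_right_mono wspace_add assms wnorm_nonneg d')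
  finally show ?thesis by simp
qed

subsection \<open>The inverse operator\<close>

lemma wonorm_bdd_above:
  assumes "wbounded d T"
  shows "bdd_above ((\<lambda>x. wnorm d (T x) / wnorm d x) ` wspace d)"
proof -
  obtain C where C: "wnorm d (T x) \<le> C * wnorm d x" if "x \<in> wspace d" for x
    using assms by (auto simp: wbounded_def)
  \<comment> \<open>The maximum covers sequences of norm zero, whose quotient is 0 by
    convention.\<close>
  have "wnorm d (T x) / wnorm d x \<le> max C 0" if "x \<in> wspace d" for x
  proof (cases "wnorm d x = 0")
    case False
    then have "wnorm d x > 0" using wnorm_nonneg[OF that] by simp
    then have "wnorm d (T x) / wnorm d x \<le> C"
      using C[OF that] by (simp add: pos_divide_le_eq)
    then show ?thesis by simp
  qed simp
  then show ?thesis by (rule bdd_aboveI2)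
qed

lemma wonorm_bound:
  assumes "wbounded d T" "x \<in> wspace d"
  shows "wnorm d (T x) \<le> wonorm d T * wnorm d x"
proof (cases "wnorm d x = 0")
  \<comment> \<open>The supremum gives no information here; boundedness itself forces the left side
    to be at most 0.\<close>
  case True
  then show ?thesis using assms by (auto simp: wbounded_def)
next
  case False
  then have "wnorm d x > 0" using wnorm_nonneg[OF assms(2)] by simp
  moreover have "wnorm d (T x) / wnorm d x \<le> wonorm d T"
    unfolding wonorm_def by (rule cSUP_upper[OF assms(2) wonorm_bdd_above[OF assms(1)]])
  ultimately show ?thesis
    by (simp add: pos_divide_le_eq)
qed

lemma wonorm_nonneg:
  assumes "wbounded d T"
  shows "wonorm d T \<ge> 0"
  using cSUP_upper[OF wspace_zero wonorm_bdd_above[OF assms]]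
  by (simp add: wonorm_def wnorm_zero)

lemma lin_op_diff:
  assumes "z \<in> wspace d" "x \<in> wspace d" "y \<in> wspace d"
  shows "lin_op d z (\<lambda>k. x k - y k) = (\<lambda>k. lin_op d z x k - lin_op d z y k)"
proof -
  have "seq_prod d z (\<lambda>k. x k + (-1) * y k) = (\<lambda>k. seq_prod d z x k + (-1) * seq_prod d z y k)"
    using assms wspace_cmult(1)[OF assms(3), of "-1"]
    by (simp only: seq_prod_add_right seq_prod_cmult_right)
  then show ?thesis by (simp add: lin_op_def algebra_simps)
qed

context
  fixes z0 :: rseq
  assumes z0: "z0 \<in> wspace d" and bij: "bij_betw (lin_op d z0) (wspace d) (wspace d)"
begin

lemma lin_op_O_inv: "y \<in> wspace d \<Longrightarrow> lin_op d z0 (O_inv d z0 y) = y"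
  unfolding O_inv_def using bij by (simp add: bij_betw_inv_into_right)

lemma O_inv_wspace: "y \<in> wspace d \<Longrightarrow> O_inv d z0 y \<in> wspace d"
  unfolding O_inv_def using bij_betwE[OF bij_betw_inv_into[OF bij]] by blast

text \<open>\<open>inv_into\<close> carries no linearity of its own. The right side is a preimage of
  the difference because \<open>lin_op\<close> is additive, and preimages are unique.\<close>

lemma O_inv_diff:
  assumes "x \<in> wspace d" "y \<in> wspace d"
  shows "O_inv d z0 (\<lambda>k. x k - y k) = (\<lambda>k. O_inv d z0 x k - O_inv d z0 y k)"
proof -
  have eq: "lin_op d z0 (\<lambda>k. O_inv d z0 x k - O_inv d z0 y k) = (\<lambda>k. x k - y k)"
    using assms by (simp add: lin_op_diff O_inv_wspace lin_op_O_inv z0)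
  have "(\<lambda>k. O_inv d z0 x k - O_inv d z0 y k) \<in> wspace d"
    using assms by (intro wspace_diff O_inv_wspace)
  from bij_betw_inv_into_left[OF bij this] show ?thesis
    unfolding eq O_inv_def[symmetric] .
qed

context
  fixes N :: nat and M :: real
  assumes bounded: "wbounded d (O_inv d z0)" and M: "M = wonorm d (O_inv d z0)"
begin

lemma M_nonneg: "M \<ge> 0"
  unfolding M by (rule wonorm_nonneg[OF bounded])

lemma O_inv_bound: "y \<in> wspace d \<Longrightarrow> wnorm d (O_inv d z0 y) \<le> M * wnorm d y"
  unfolding M by (rule wonorm_bound[OF bounded])

section \<open>Estimates for the map G and the meaning of its fixed points\<close>

lemma G_arg_wspace:
  "r \<in> wspace d \<Longrightarrow> (\<lambda>k. bullet_prod d N z0 z0 k + seq_prod d r r k) \<in> wspace d"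
  by (intro wspace_add bullet_prod_wspace seq_prod_wspace z0)

lemma G_map_wspace: "r \<in> wspace d \<Longrightarrow> G_map d N z0 r \<in> wspace d"
  unfolding G_map_def by (intro O_inv_wspace G_arg_wspace)

lemma G_map_norm:
  assumes "r \<in> wspace d"
  shows "wnorm d (G_map d N z0 r) \<le> M * (sqrt (qN N) * (wnorm d z0)\<^sup>2 + (wnorm d r)\<^sup>2)"
proof -
  have "wnorm d (G_map d N z0 r)
      \<le> M * wnorm d (\<lambda>k. bullet_prod d N z0 z0 k + seq_prod d r r k)"
    unfolding G_map_def by (intro O_inv_bound G_arg_wspace assms)
  also have "wnorm d (\<lambda>k. bullet_prod d N z0 z0 k + seq_prod d r r k)
      \<le> wnorm d (bullet_prod d N z0 z0) + wnorm d (seq_prod d r r)"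
    by (intro wspace_add bullet_prod_wspace seq_prod_wspace z0 assms)
  also have "\<dots> \<le> sqrt (qN N) * (wnorm d z0)\<^sup>2 + (wnorm d r)\<^sup>2"
    unfolding power2_eq_square
    by (intro add_mono bullet_prod_wspace seq_prod_wspace z0 assms)
  finally show ?thesis
    using M_nonneg by (simp add: mult_left_mono)
qed

lemma G_map_diff:
  assumes "x \<in> wspace d" "y \<in> wspace d"
  shows "wnorm d (\<lambda>k. G_map d N z0 x k - G_map d N z0 y k)
    \<le> M * (wnorm d x + wnorm d y) * wnorm d (\<lambda>k. x k - y k)"
proof -
  \<comment> \<open>The constant term \<open>bullet_prod d N z0 z0\<close> cancels.\<close>
  have "(\<lambda>k. G_map d N z0 x k - G_map d N z0 y k)
      = O_inv d z0 (\<lambda>k. seq_prod d x x k - seq_prod d y y k)"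
    unfolding G_map_def by (subst O_inv_diff[symmetric]) (auto intro: G_arg_wspace assms)
  then have "wnorm d (\<lambda>k. G_map d N z0 x k - G_map d N z0 y k)
      \<le> M * wnorm d (\<lambda>k. seq_prod d x x k - seq_prod d y y k)"
    using assms by (simp add: O_inv_bound wspace_diff seq_prod_wspace)
  also have "\<dots> \<le> M * ((wnorm d x + wnorm d y) * wnorm d (\<lambda>k. x k - y k))"
    by (intro mult_left_mono seq_prod_square_diff assms M_nonneg)
  finally show ?thesis by (simp add: mult.assoc)
qed

text \<open>Applying \<open>lin_op\<close> to the fixed-point equation expresses r - 2 z0 x r
  through the tail of z0 x z0 and r x r. Adding the projected equation for \<open>z0\<close>
  restores the full z0 x z0, and the right side becomes the square of z0 + r.\<close>

lemma fixed_point_idempotent: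
  assumes r: "r \<in> wspace d" "G_map d N z0 r = r" and idem: "z0 = circ_prod d N z0 z0"
  shows "(\<lambda>k. z0 k + r k) = seq_prod d (\<lambda>k. z0 k + r k) (\<lambda>k. z0 k + r k)"
proof
  fix k
  have "lin_op d z0 r = (\<lambda>k. bullet_prod d N z0 z0 k + seq_prod d r r k)"
    using lin_op_O_inv[OF G_arg_wspace[OF r(1)]] r(2) by (simp add: G_map_def)
  from fun_cong[OF this, of k] have "r k - 2 * seq_prod d z0 r k = bullet_prod d N z0 z0 k + seq_prod d r r k"
    by (simp only: lin_op_def)
  moreover have "z0 k = proj N (seq_prod d z0 z0) k"
    using idem unfolding circ_prod_def by (rule fun_cong)
  moreover have "seq_prod d (\<lambda>k. z0 k + r k) (\<lambda>k. z0 k + r k) k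
      = seq_prod d z0 z0 k + 2 * seq_prod d z0 r k + seq_prod d r r k"
    using z0 r(1) seq_prod_commute[OF r(1) z0]
    by (simp add: seq_prod_add_left seq_prod_add_right wspace_add)
  ultimately show "z0 k + r k = seq_prod d (\<lambda>k. z0 k + r k) (\<lambda>k. z0 k + r k) k"
    by (simp add: bullet_prod_def)
qed

end

end

end

text \<open>The closed form of the generating function makes \<open>\<epsilon>\<close> the smaller root of
  \<open>M (q + \<epsilon>\<^sup>2) = \<epsilon>\<close>; for \<open>M = 0\<close> this still holds because \<open>1 / 0 = 0\<close>.\<close>

lemma eps_root:
  fixes M q \<epsilon> :: real
  assumes "M \<ge> 0" "q \<ge> 0" and x: "4 * M\<^sup>2 * q < 1"
    and \<epsilon>: "\<epsilon> = 1 / (2 * M) * (\<Sum>n. eps_coeff (Suc n) * (4 * M\<^sup>2 * q) ^ Suc n)"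
  shows "\<epsilon> \<ge> 0" "M * (q + \<epsilon>\<^sup>2) = \<epsilon>"
proof -
  define s where "s = sqrt (1 - 4 * M\<^sup>2 * q)"
  have eps: "\<epsilon> = (1 - s) / (2 * M)"
    using assms eps_series[of "4 * M\<^sup>2 * q"] by (simp add: s_def)
  have s2: "s\<^sup>2 = 1 - 4 * M\<^sup>2 * q"
    unfolding s_def using x by simp
  have "s \<le> 1"
    unfolding s_def using assms by (simp add: real_sqrt_le_1_iff)
  then show "\<epsilon> \<ge> 0" using assms(1) eps by simp
  show "M * (q + \<epsilon>\<^sup>2) = \<epsilon>"
  proof (cases "M = 0")
    case False
    then have e: "2 * M * \<epsilon> = 1 - s" by (simp add: eps)
    \<comment> \<open>With 4 M^2 q = 1 - s^2 and 2 M epsilon = 1 - s, the right side is (1 - s^2) +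
      (1 - s)^2 = 2 (1 - s).\<close>
    have "4 * M * (M * (q + \<epsilon>\<^sup>2)) = 4 * M\<^sup>2 * q + (2 * M * \<epsilon>)\<^sup>2"
      by (simp add: power2_eq_square algebra_simps)
    also have "\<dots> = 2 * (2 * M * \<epsilon>)"
      unfolding e using s2 by (simp add: power2_eq_square algebra_simps)
    finally show ?thesis using False by simp
  qed (simp add: eps)
qed

section \<open>The fixed-point iteration\<close>

theorem lemma2p7p2:
  fixes d \<kappa> M \<epsilon> K :: real and N :: nat and z0 :: rseq and r :: "nat \<Rightarrow> rseq"
  assumes "d > 2"
    and "z0 \<in> proj N ` wspace d"
    and "z0 = circ_prod d N z0 z0"
    and "bij_betw (lin_op d z0) (wspace d) (wspace d)"
    and "wbounded d (O_inv d z0)"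
    and "\<kappa> = wnorm d z0"
    and "M = wonorm d (O_inv d z0)"
    and "4 * M\<^sup>2 * \<kappa>\<^sup>2 * sqrt (qN N) < 1"
    and "\<epsilon> = 1 / (2 * M) *
           (\<Sum>n. eps_coeff (Suc n) * (4 * sqrt (qN N) * M\<^sup>2 * \<kappa>\<^sup>2) ^ Suc n)"
    and "K = 2 * M * \<epsilon>"
    and "r 0 = (\<lambda>_. 0)"
    and "\<And>n. r (Suc n) = G_map d N z0 (r n)"
  shows "G_map d N z0 ` wcball d \<epsilon> \<subseteq> wcball d \<epsilon> \<and>
    (\<forall>r1\<in>wball d \<epsilon>. \<forall>r2\<in>wball d \<epsilon>.
       wnorm d (\<lambda>k. G_map d N z0 r1 k - G_map d N z0 r2 k) \<le> K * wnorm d (\<lambda>k. r1 k - r2 k)) \<and>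
    (K < 1 \<longrightarrow>
       (\<exists>rs. wlim d r rs \<and>
             wlim d (\<lambda>m k. \<Sum>n=1..m. r n k - r (n - 1) k) rs \<and>
             G_map d N z0 rs = rs \<and>
             wnorm d rs \<le> M * sqrt (qN N) * \<kappa>\<^sup>2 / (1 - K) \<and>
             (let z = (\<lambda>k. z0 k + rs k) in z = seq_prod d z z)))"
proof -
  note d = assms(1)
  obtain x where "z0 = proj N x" "x \<in> wspace d" using assms(2) by auto
  then have "summable (\<lambda>n. \<bar>z0 n\<bar> * rho d ^ n)"
    by (intro summable_finite[of "{..N}"]) (auto simp: proj_def)
  then have z0: "z0 \<in> wspace d" by (simp add: wspace_def)
  note ctx = d z0 assms(4)
  note ctxM = ctx assms(5,7)
  define q where "q = sqrt (qN N) * \<kappa>\<^sup>2"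
  have M: "M \<ge> 0" by (rule M_nonneg[OF ctxM])
  have q: "q \<ge> 0" using qN_nonneg by (simp add: q_def)
  have x: "4 * sqrt (qN N) * M\<^sup>2 * \<kappa>\<^sup>2 = 4 * M\<^sup>2 * q"
    "4 * M\<^sup>2 * \<kappa>\<^sup>2 * sqrt (qN N) = 4 * M\<^sup>2 * q"
    by (simp_all add: q_def)
  have eps: "\<epsilon> \<ge> 0" "M * (q + \<epsilon>\<^sup>2) = \<epsilon>"
    using eps_root[OF M q assms(8)[unfolded x] assms(9)[unfolded x]] by auto
  have K: "K \<ge> 0" using assms(10) M eps by simp
  let ?G = "G_map d N z0"
  have G: "?G x \<in> wcball d \<epsilon>" if "x \<in> wcball d \<epsilon>" for x
  proof -
    have x: "x \<in> wspace d" "wnorm d x \<le> \<epsilon>" using that by (auto simp: wcball_def)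
    have "wnorm d (?G x) \<le> M * (q + (wnorm d x)\<^sup>2)"
      using G_map_norm[OF ctxM x(1), of N] assms(6) by (simp add: q_def)
    also have "\<dots> \<le> M * (q + \<epsilon>\<^sup>2)"
      using x wnorm_nonneg[OF d x(1)] M by (intro mult_left_mono add_left_mono power_mono) auto
    finally show ?thesis
      using eps G_map_wspace[OF ctxM x(1)] by (simp add: wcball_def)
  qed
  \<comment> \<open>Proved on the closed ball, where the iterates and their limit are known to lie;
    the claim for the open ball follows by inclusion.\<close>
  have lip: "wnorm d (\<lambda>k. ?G x k - ?G y k) \<le> K * wnorm d (\<lambda>k. x k - y k)"
    if "x \<in> wcball d \<epsilon>" "y \<in> wcball d \<epsilon>" for x y
  proof -
    have xy: "x \<in> wspace d" "wnorm d x \<le> \<epsilon>" "y \<in> wspace d" "wnorm d y \<le> \<epsilon>"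
      using that by (auto simp: wcball_def)
    have "wnorm d (\<lambda>k. ?G x k - ?G y k) \<le> M * (wnorm d x + wnorm d y) * wnorm d (\<lambda>k. x k - y k)"
      by (rule G_map_diff[OF ctxM xy(1,3)])
    also have "\<dots> \<le> M * (\<epsilon> + \<epsilon>) * wnorm d (\<lambda>k. x k - y k)"
      using xy M by (intro mult_right_mono mult_left_mono wnorm_nonneg[OF d] wspace_diff[OF d]) auto
    finally show ?thesis using assms(10) by (simp add: mult_ac)
  qed
  have "\<exists>rs. wlim d r rs \<and> wlim d (\<lambda>m k. \<Sum>n=1..m. r n k - r (n - 1) k) rs \<and> ?G rs = rs \<and>
      wnorm d rs \<le> M * sqrt (qN N) * \<kappa>\<^sup>2 / (1 - K) \<and>
      (let z = (\<lambda>k. z0 k + rs k) in z = seq_prod d z z)" if K1: "K < 1"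
  proof -
    have r: "r n \<in> wcball d \<epsilon>" for n
      by (induction n) (use eps G wspace_zero[OF d] wnorm_zero[OF d] assms(11,12) in \<open>auto simp: wcball_def\<close>)
    have rw: "r n \<in> wspace d" for n using r[of n] by (auto simp: wcball_def)
    define u where "u = (\<lambda>n k. r (Suc n) k - r n k)"
    have uw: "u n \<in> wspace d" for n
      unfolding u_def by (intro wspace_diff d rw)
    \<comment> \<open>The first increment is G(0), of norm at most \<open>M * q\<close>; each
      further step contracts by \<open>K\<close>.\<close>
    have u_le: "wnorm d (u n) \<le> K ^ n * (M * q)" for n
    proof (induction n)
      case 0
      show ?case
        using G_map_norm[OF ctxM wspace_zero[OF d], of N] assms(6)
        by (simp add: u_def assms(11,12) wnorm_zero[OF d] q_def)
    next
      case (Suc n)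
      have "wnorm d (u (Suc n)) \<le> K * wnorm d (u n)"
        using lip[OF r[of "Suc n"] r[of n]] by (simp add: u_def assms(12))
      also have "\<dots> \<le> K * (K ^ n * (M * q))"
        by (intro mult_left_mono Suc K)
      finally show ?case by (simp add: mult_ac)
    qed
    have geo: "summable (\<lambda>n. K ^ n * (M * q))"
      using K K1 by (intro summable_mult2 summable_geometric) simp
    have su: "summable (\<lambda>n. wnorm d (u n))"
      by (rule summable_comparison_test'[OF geo, of 0])
        (use u_le wnorm_nonneg[OF d uw] in auto)
    have part: "(\<Sum>j<n. u j k) = r n k" for n k
      unfolding u_def by (induction n) (auto simp: assms(11))
    obtain rs where lim: "wlim d r rs"
      using wspace_complete[OF d uw su] unfolding part by metis
    then have rsw: "rs \<in> wspace d" and l0: "(\<lambda>n. wnorm d (\<lambda>k. r n k - rs k)) \<longlonglongrightarrow> 0"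
      by (auto simp: wlim_def)
    \<comment> \<open>Closed balls are closed under limits. This is used with the radius epsilon and
      again with \<open>M * q / (1 - K)\<close>.\<close>
    have norm_le: "wnorm d rs \<le> C" if "\<And>n. wnorm d (r n) \<le> C" for C
    proof -
      have "wnorm d rs \<le> C + wnorm d (\<lambda>k. r n k - rs k)" for n
        using wspace_diff(2)[OF d rw[of n] wspace_diff(1)[OF d rw[of n] rsw]] that[of n] by simp
      moreover have "(\<lambda>n. C + wnorm d (\<lambda>k. r n k - rs k)) \<longlonglongrightarrow> C + 0"
        by (intro tendsto_intros l0)
      ultimately show ?thesis
        using LIMSEQ_le_const by fastforce
    qed
    have rsb: "rs \<in> wcball d \<epsilon>"
      using norm_le[of \<epsilon>] r rsw by (auto simp: wcball_def)
    have "wnorm d rs \<le> M * q / (1 - K)"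
    proof (rule norm_le)
      fix n
      have "wnorm d (r n) \<le> (\<Sum>j<n. wnorm d (u j))"
      proof (induction n)
        case (Suc n)
        have "wnorm d (r (Suc n)) \<le> wnorm d (r n) + wnorm d (u n)"
          using wspace_add(2)[OF d rw[of n] uw[of n]] by (simp add: u_def)
        then show ?case using Suc by simp
      qed (simp add: assms(11) wnorm_zero[OF d])
      also have "\<dots> \<le> (\<Sum>j<n. K ^ j * (M * q))"
        by (intro sum_mono u_le)
      also have "\<dots> \<le> (\<Sum>j. K ^ j * (M * q))"
        using geo K M q by (intro sum_le_suminf) auto
      also have "\<dots> = M * q / (1 - K)"
        using K K1 suminf_mult2[OF summable_geometric[of K], of "M * q"]
        by (simp add: suminf_geometric)
      finally show "wnorm d (r n) \<le> M * q / (1 - K)" .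
    qed
    then have bound: "wnorm d rs \<le> M * sqrt (qN N) * \<kappa>\<^sup>2 / (1 - K)"
      by (simp add: q_def mult.assoc)
    have fixed: "?G rs = rs"
    proof -
      have Gw: "?G rs \<in> wspace d" by (rule G_map_wspace[OF ctxM rsw])
      \<comment> \<open>Triangle inequality through \<open>r (Suc n)\<close>, which is G applied to
        \<open>r n\<close>; both terms tend to 0.\<close>
      have le: "wnorm d (\<lambda>k. ?G rs k - rs k)
          \<le> K * wnorm d (\<lambda>k. r n k - rs k) + wnorm d (\<lambda>k. r (Suc n) k - rs k)" for n
        using wnorm_diff_triangle[OF d Gw rw[of "Suc n"] rsw] lip[OF rsb r[of n]]
          wnorm_diff_commute[OF d, of rs "r n"]
        by (simp add: assms(12))
      have "(\<lambda>n. K * wnorm d (\<lambda>k. r n k - rs k) + wnorm d (\<lambda>k. r (Suc n) k - rs k))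
          \<longlonglongrightarrow> K * 0 + 0"
        by (intro tendsto_intros l0 LIMSEQ_Suc[OF l0])
      then have "wnorm d (\<lambda>k. ?G rs k - rs k) \<le> K * 0 + 0"
        by (rule LIMSEQ_le_const) (use le in blast)
      then have "wnorm d (\<lambda>k. ?G rs k - rs k) = 0"
        using wnorm_nonneg[OF d wspace_diff(1)[OF d Gw rsw]] by simp
      from wnorm_eq_0[OF d wspace_diff(1)[OF d Gw rsw] this] show ?thesis
        by (auto simp: fun_eq_iff)
    qed
    \<comment> \<open>Since \<open>r 0\<close> is zero, the partial sums telescope to
      \<open>r\<close> itself, so both limit claims coincide.\<close>
    have tele: "(\<lambda>m k. \<Sum>n=1..m. r n k - r (n - 1) k) = r"
    proof (intro ext)
      show "(\<Sum>n=1..m. r n k - r (n - 1) k) = r m k" for m k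
        by (induction m) (auto simp: assms(11))
    qed
    show ?thesis
      unfolding tele Let_def
      using lim fixed bound fixed_point_idempotent[OF ctxM rsw fixed assms(3)] by blast
  qed
  moreover have "wball d \<epsilon> \<subseteq> wcball d \<epsilon>"
    by (auto simp: wball_def wcball_def)
  ultimately show ?thesis
    using G lip by blast
qed

end
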